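(* Let $\mathcal{A}=(Q,A,\cdot,\circ)$ be an invertible transducer such that the group $G=\mathcal{G}(\mathcal{A})$ is not finite. Then for every nonempty word $u\in A^{*}$ whose image in the semigroup $\mathcal{S}((\partial\mathcal{A})^{-})$ generated by the enriched dual of $\mathcal{A}$ is an element of finite order, the stabilizer $\mathrm{Stab}_{G}(u^{\omega})$ is non-trivial.
   Context: A transducer $\mathcal{A}=(Q,A,\cdot,\circ)$ consists of a finite set $Q$ of states, a finite alphabet $A$, a transition map $Q\times A\to Q$, $(q,a)\mapsto q\cdot a$, and an output map $Q\times A\to A$, $(q,a)\mapsto q\circ a$. There is an edge $q\xrightarrow{a|b}p$ iff $q\cdot a=p$ and $q\circ a=b$. Each state $q$ acts on $A^{*}$ (and on the set $A^\omega$ of right-infinite words) by $q\circ(a_1a_2\ldots)=(q\circ a_1)\,((q\cdot a_1)\circ(a_2\ldots))$; the semigroup generated by the maps $u\mapsto q\circ u$ ($q\in Q$) on $A^*$ is $\mathcal{S}(\mathcal{A})$; a nonempty word over $Q$ is identified with the corresponding product in $\mathcal{S}(\mathcal{A})$. $\mathcal{A}$ is invertible if for each $q$ the map $a\mapsto q\circ a$ is a permutation of $A$; then the states act by automorphisms of the rooted tree $A^*$ and generate a group $\mathcal{G}(\mathcal{A})$, which also acts on $A^\omega$. The dual $\partial\mathcal{A}$ is the transducer with state set $A$ and alphabet $Q$ with edges $a\xrightarrow{p|q}b$ for each edge $p\xrightarrow{a|b}q$ of $\mathcal{A}$. For invertible $\mathcal{A}$, the enriched dual $(\partial\mathcal{A})^{-}$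 is the transducer with state set $A$ and alphabet $\tilde Q=Q\sqcup Q^{-1}$ ($Q^{-1}$ the set of formal inverses) obtained from $\partial\mathcal{A}$ by adding, for each edge $a\xrightarrow{p|q}b$, the edge $b\xrightarrow{p^{-1}|q^{-1}}a$ (this is well defined). An element $s$ of a semigroup has finite order if the subsemigroup $\{s^i: i\ge1\}$ is finite. $u^\omega=uuu\cdots$, and $\mathrm{Stab}_G(\xi)=\{g\in G: g(\xi)=\xi\}$. *)

theory Defs
  imports "HOL-Algebra.Group_Action" "HOL-Algebra.Generated_Groups" "HOL-Library.Stream"
begin

text \<open>
  States and alphabet are whole types. Their finiteness is not part of the record; it is
  imposed through the sort \<open>finite\<close> where it is needed.
\<close>

record ('q, 'a) transducer =
  next_state :: "'q \<Rightarrow> 'a \<Rightarrow> 'q"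
  out_letter :: "'q \<Rightarrow> 'a \<Rightarrow> 'a"

definition edge :: "('q, 'a) transducer \<Rightarrow> 'q \<Rightarrow> 'a \<Rightarrow> 'a \<Rightarrow> 'q \<Rightarrow> bool" where
  "edge T q a b p \<longleftrightarrow> next_state T q a = p \<and> out_letter T q a = b"

definition invertible_transducer :: "('q, 'a) transducer \<Rightarrow> bool" where
  "invertible_transducer T \<longleftrightarrow> (\<forall>q. bij (out_letter T q))"

primrec act :: "('q, 'a) transducer \<Rightarrow> 'q \<Rightarrow> 'a list \<Rightarrow> 'a list" where
  "act T q [] = []"
| "act T q (a # w) = out_letter T q a # act T (next_state T q a) w"


subsection \<open>The semigroup of a transducer\<close>

inductive_set transducer_semigroup :: "('q, 'a) transducer \<Rightarrow> ('a list \<Rightarrow> 'a list) set"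
  for T where
  gen: "act T q \<in> transducer_semigroup T"
| mult: "f \<in> transducer_semigroup T \<Longrightarrow> g \<in> transducer_semigroup T \<Longrightarrow> g \<circ> f \<in> transducer_semigroup T"

text \<open>
  A word over the states denotes a product in which the leftmost letter acts first. This is
  the order compatible with duality: reading \<open>a\<^sub>1 \<dots> a\<^sub>n\<close> from state \<open>q\<close> leads to the state
  obtained by applying to \<open>q\<close> first \<open>a\<^sub>1\<close>, then \<open>a\<^sub>2\<close>, and so on, as states of the dual
  (see \<open>word_elem_dual\<close> below).
\<close>

definition word_elem :: "('q, 'a) transducer \<Rightarrow> 'q list \<Rightarrow> 'a list \<Rightarrow> 'a list" where
  "word_elem T v = fold (act T) v"

lemma transducer_semigroup_eq: "transducer_semigroup T = word_elem T ` {v. v \<noteq> []}"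
proof (intro equalityI subsetI)
  fix f assume "f \<in> transducer_semigroup T"
  then show "f \<in> word_elem T ` {v. v \<noteq> []}"
  proof induction
    case (gen q)
    have "act T q = word_elem T [q]"
      by (simp add: word_elem_def)
    then show ?case by blast
  next
    case (mult f g)
    then obtain v w where "f = word_elem T v" "g = word_elem T w" "v \<noteq> []" "w \<noteq> []"
      by blast
    then have "g \<circ> f = word_elem T (v @ w)" "v @ w \<noteq> []"
      by (simp_all add: word_elem_def)
    then show ?case by blast
  qed
next
  fix f assume "f \<in> word_elem T ` {v. v \<noteq> []}"
  then obtain v where v: "v \<noteq> []" "f = word_elem T v" by blast
  from v(1) have "word_elem T v \<in> transducer_semigroup T"
  proof (induction v rule: list_nonempty_induct)
    case (single q)
    then show ?case
      using transducer_semigroup.gen[of T q] by (simp add: word_elem_def)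
  next
    case (cons q v)
    then show ?case
      using transducer_semigroup.mult[OF transducer_semigroup.gen[of T q] cons.IH]
      by (simp add: word_elem_def comp_def)
  qed
  with v show "f \<in> transducer_semigroup T" by simp
qed

definition finite_order :: "('b \<Rightarrow> 'b) \<Rightarrow> bool" where
  "finite_order s \<longleftrightarrow> finite {s ^^ i | i. i \<ge> 1}"


subsection \<open>Dual and enriched dual\<close>

definition dual :: "('q, 'a) transducer \<Rightarrow> ('a, 'q) transducer" where
  "dual T = \<lparr>next_state = \<lambda>a p. out_letter T p a, out_letter = \<lambda>a p. next_state T p a\<rparr>"

lemma edge_dual: "edge (dual T) a p q b \<longleftrightarrow> edge T p a b q"
  by (auto simp: edge_def dual_def)

lemma word_elem_dual:
  "word_elem (dual T) v [q] = [fold (\<lambda>a p. next_state T p a) v q]"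
  by (induction v arbitrary: q) (simp_all add: word_elem_def dual_def)

text \<open>
  In the alphabet \<open>'q + 'q\<close> of the enriched dual, \<open>Inl q\<close> is the letter \<open>q\<close> and \<open>Inr q\<close> is
  its formal inverse.
\<close>

definition enriched_dual :: "('q, 'a) transducer \<Rightarrow> ('a, 'q + 'q) transducer" where
  "enriched_dual T =
    (let src = (\<lambda>b p. THE a. next_state (dual T) a p = b) in
      \<lparr>next_state = (\<lambda>b x. case x of Inl p \<Rightarrow> next_state (dual T) b p | Inr p \<Rightarrow> src b p),
       out_letter = (\<lambda>b x. case x of Inl p \<Rightarrow> Inl (out_letter (dual T) b p)
                                   | Inr p \<Rightarrow> Inr (out_letter (dual T) (src b p) p))\<rparr>)"

lemma edge_enriched_dual:
  assumes "invertible_transducer T"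
  shows "edge (enriched_dual T) c x y d \<longleftrightarrow>
    (\<exists>p q. x = Inl p \<and> y = Inl q \<and> edge (dual T) c p q d) \<or>
    (\<exists>p q. x = Inr p \<and> y = Inr q \<and> edge (dual T) d p q c)"
proof -
  have src: "(THE a. out_letter T p a = c) = d \<longleftrightarrow> out_letter T p d = c" for p c d
  proof -
    have "bij (out_letter T p)"
      using assms by (simp add: invertible_transducer_def)
    then have "\<exists>!a. out_letter T p a = c"
      by (simp add: bij_iff)
    then obtain a where "\<And>x. out_letter T p x = c \<longleftrightarrow> x = a"
      by auto
    then show ?thesis by auto
  qed
  have src_out: "(THE a. out_letter T p a = out_letter T p d) = d" for p d
    by (simp add: src)
  show ?thesis
    by (cases x) (auto simp: src src_out edge_def enriched_dual_def dual_def)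
qed


subsection \<open>The group of an invertible transducer\<close>

definition transducer_group :: "('q, 'a) transducer \<Rightarrow> ('a list \<Rightarrow> 'a list) monoid" where
  "transducer_group T =
    (BijGroup UNIV)\<lparr>carrier := generate (BijGroup UNIV) (range (act T))\<rparr>"

lemma act_in_BijGroup:
  assumes "invertible_transducer T"
  shows "act T q \<in> carrier (BijGroup UNIV)"
proof -
  have bij: "bij (out_letter T q)" for q
    using assms by (simp add: invertible_transducer_def)
  have "act T q v = act T q w \<Longrightarrow> v = w" for v w
  proof (induction v arbitrary: q w)
    case Nil
    then show ?case by (cases w) auto
  next
    case (Cons a v)
    then show ?case
      using bij_is_inj[OF bij] by (cases w) (auto dest: injD)
  qed
  moreover have "\<exists>v. act T q v = w" for w
  proof (induction w arbitrary: q)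
    case Nil
    show ?case by (rule exI[of _ "[]"]) simp
  next
    case (Cons b w)
    obtain a where "out_letter T q a = b"
      using bij_is_surj[OF bij] by (metis surjD)
    moreover obtain v where "act T (next_state T q a) v = w"
      using Cons.IH by blast
    ultimately have "act T q (a # v) = b # w" by simp
    then show ?case by blast
  qed
  ultimately have "bij (act T q)"
    by (metis bijI injI surjI)
  then show ?thesis
    by (simp add: BijGroup_def Bij_def)
qed

lemma group_transducer_group:
  assumes "invertible_transducer T"
  shows "group (transducer_group T)"
proof -
  interpret B: group "BijGroup (UNIV :: 'b list set)"
    by (rule group_BijGroup)
  have "subgroup (generate (BijGroup UNIV) (range (act T))) (BijGroup UNIV)"
    using act_in_BijGroup[OF assms] by (intro B.generate_is_subgroup) auto
  then show ?thesis
    unfolding transducer_group_def by (rule B.subgroup_imp_group)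
qed

text \<open>
  The action on infinite words induced by a length- and prefix-preserving map on finite words:
  the letter at position \<open>n\<close> is read off the image of the prefix of length \<open>n + 1\<close>.
\<close>

definition stream_act :: "('a list \<Rightarrow> 'a list) \<Rightarrow> 'a stream \<Rightarrow> 'a stream" where
  "stream_act g \<xi> = smap (\<lambda>n. g (stake (Suc n) \<xi>) ! n) nats"

lemma stream_act_act:
  "stream_act (act T q) (a ## \<xi>) = out_letter T q a ## stream_act (act T (next_state T q a)) \<xi>"
proof -
  have "smap (\<lambda>n. act T q (stake (Suc n) (a ## \<xi>)) ! n) (fromN (Suc 0)) =
      smap (\<lambda>n. act T (next_state T q a) (stake (Suc n) \<xi>) ! n) nats"
    by (simp add: smap_alt)
  then show ?thesis
    unfolding stream_act_def by (subst siterate.code) simp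
qed

lemma stake_stream_act:
  assumes "invertible_transducer T" and "g \<in> carrier (transducer_group T)"
  shows "stake n (stream_act g \<xi>) = g (stake n \<xi>)"
proof -
  define P :: "('b list \<Rightarrow> 'b list) \<Rightarrow> bool" where
    "P f \<longleftrightarrow> (\<forall>w. length (f w) = length w) \<and> (\<forall>w k. f (take k w) = take k (f w))" for f
  have take_act: "act T q (take k w) = take k (act T q w)" for q k w
  proof (induction w arbitrary: q k)
    case (Cons a w)
    then show ?case by (cases k) auto
  qed simp
  have length_act: "length (act T q w) = length w" for q w
    by (induction w arbitrary: q) auto
  have P_act: "P (act T q)" for q
    by (simp add: P_def take_act length_act)
  have P_inv: "P (inv_into UNIV f)" if "P f" "bij f" for f
  proof -
    have f: "f (inv_into UNIV f w) = w" "inv_into UNIV f (f w) = w" for w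
      using \<open>bij f\<close> by (simp_all add: bij_is_surj surj_f_inv_f bij_is_inj)
    have "length (inv_into UNIV f w) = length w" for w
      using \<open>P f\<close> f by (metis P_def)
    moreover have "inv_into UNIV f (take k w) = take k (inv_into UNIV f w)" for k w
      using \<open>P f\<close> f by (metis P_def)
    ultimately show ?thesis by (simp add: P_def)
  qed
  interpret B: group "BijGroup (UNIV :: 'b list set)"
    by (rule group_BijGroup)
  have "g \<in> generate (BijGroup UNIV) (range (act T))"
    using assms(2) by (simp add: transducer_group_def)
  then have "P g \<and> g \<in> carrier (BijGroup UNIV)"
  proof induction
    case one
    have "P (\<one>\<^bsub>BijGroup UNIV\<^esub>)"
      by (simp add: P_def BijGroup_def)
    then show ?case
      using B.one_closed by blast
  next
    case (incl h)
    then show ?case using P_act act_in_BijGroup[OF assms(1)] by auto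
  next
    case (inv h)
    then have h: "P h" "h \<in> carrier (BijGroup UNIV)"
      using P_act act_in_BijGroup[OF assms(1)] by auto
    then have "h \<in> Bij UNIV" and "bij h"
      by (simp_all add: BijGroup_def Bij_def)
    then have "inv\<^bsub>BijGroup UNIV\<^esub> h = inv_into UNIV h"
      by (simp add: inv_BijGroup restrict_def)
    moreover have "inv\<^bsub>BijGroup UNIV\<^esub> h \<in> carrier (BijGroup UNIV)"
      using h(2) by (rule B.inv_closed)
    ultimately show ?case
      using P_inv[OF h(1) \<open>bij h\<close>] by simp
  next
    case (eng h1 h2)
    then have "h1 \<otimes>\<^bsub>BijGroup UNIV\<^esub> h2 = (\<lambda>w. h1 (h2 w))"
      by (simp add: BijGroup_def compose_def restrict_def)
    with eng.IH have "P (h1 \<otimes>\<^bsub>BijGroup UNIV\<^esub> h2)"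
      by (simp add: P_def)
    with eng.IH show ?case
      using B.m_closed by blast
  qed
  then have len: "length (g w) = length w" and pre: "g (take k w) = take k (g w)" for k w
    by (simp_all add: P_def)
  show ?thesis
  proof (rule nth_equalityI)
    show "length (stake n (stream_act g \<xi>)) = length (g (stake n \<xi>))"
      by (simp add: len)
  next
    fix i assume "i < length (stake n (stream_act g \<xi>))"
    then have i: "i < n" by simp
    then have "stake (Suc i) \<xi> = take (Suc i) (stake n \<xi>)"
      by (simp add: take_stake min_def)
    then have "g (stake (Suc i) \<xi>) ! i = g (stake n \<xi>) ! i"
      by (simp only: pre) simp
    with i show "stake n (stream_act g \<xi>) ! i = g (stake n \<xi>) ! i"
      by (simp add: stream_act_def del: stake.simps)
  qed
qed

end

theory Submission
  imports Defs
begin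

text \<open>
  The reason is that \<open>u\<^sup>\<omega>\<close> has a finite orbit, so that the infinite group \<open>G\<close> cannot act freely
  on it. Write \<open>s\<close> for the action of \<open>u\<close> on words over the states and their formal inverses,
  and let a group element \<open>g\<close> be represented by such a word \<open>w\<close>. By duality
  (\<open>word_elem_dual_append\<close>), \<open>g\<close> acts after the prefix \<open>u\<close> like the word \<open>s w\<close>, so the successive
  blocks of \<open>g(u\<^sup>\<omega>)\<close> are the words \<open>w(u), (s w)(u), (s\<^sup>2 w)(u), \<dots>\<close>. If \<open>s\<close> has finite order,
  there are only finitely many maps \<open>s\<^sup>k\<close>, and \<open>g(u\<^sup>\<omega>)\<close> is determined by the function that
  sends \<open>s\<^sup>k\<close> to the word \<open>(s\<^sup>k w)(u)\<close>, which has length \<open>\<bar>u\<bar>\<close>. Since \<open>A\<close> is finite, there are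
  only finitely many such functions. Hence two distinct elements \<open>g, h\<close> of \<open>G\<close> agree on \<open>u\<^sup>\<omega>\<close>,
  and \<open>h\<inverse>g\<close> is a non-trivial element of the stabilizer.

  That every group element is given by a word over \<open>Q \<squnion> Q\<inverse>\<close> is
  \<open>transducer_group_elem_word\<close>: dualizing the enriched dual once more yields the transducer that
  generates \<open>G\<close> as a semigroup.
\<close>

lemma dual_dual [simp]: "dual (dual T) = T"
  by (simp add: dual_def)

lemma word_elem_Nil [simp]: "word_elem T [] = id"
  by (simp add: word_elem_def id_def)

lemma word_elem_Cons [simp]: "word_elem T (q # v) = word_elem T v \<circ> act T q"
  by (simp add: word_elem_def)

lemma word_elem_append: "word_elem T (v @ w) = word_elem T w \<circ> word_elem T v"
  by (simp add: word_elem_def)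

lemma length_act [simp]: "length (act T q v) = length v"
  by (induction v arbitrary: q) auto

lemma length_word_elem [simp]: "length (word_elem T w v) = length v"
  by (induction w arbitrary: v) auto

text \<open>
  As the letter \<open>a\<close> passes through the states of \<open>w\<close> in turn, each of them makes one transition;
  the same transitions, read in the dual, are the run of \<open>a\<close> on the input \<open>w\<close>. The dual output
  of that run is therefore the section of the product \<open>w\<close> at \<open>a\<close>.
\<close>

lemma word_elem_dual_Cons:
  "word_elem T w (a # v) = word_elem T w [a] @ word_elem T (act (dual T) a w) v"
proof (induction w arbitrary: a v)
  case (Cons q w)
  show ?case
    using Cons.IH[of "out_letter T q a" "act T (next_state T q a) v"]
    by (simp add: dual_def)
qed simp

lemma word_elem_dual_append:
  "word_elem T w (u @ v) = word_elem T w u @ word_elem T (word_elem (dual T) u w) v"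
proof (induction u arbitrary: w)
  case Nil
  have "word_elem T w [] = []"
    by (metis length_0_conv length_word_elem)
  then show ?case by simp
next
  case (Cons a u)
  show ?case
    by (simp add: word_elem_dual_Cons[of T w a "u @ v"] word_elem_dual_Cons[of T w a u] Cons.IH)
qed

text \<open>
  The section at \<open>u\<^sup>k\<close> of the product \<open>w\<close> is the image of \<open>w\<close> under the \<open>k\<close>-th iterate of \<open>u\<close> as an
  element of the dual semigroup, so the hypothesis compares the two images of \<open>u\<^sup>n\<close> block by
  block.
\<close>

lemma word_elem_power_eqI:
  assumes "\<And>k. word_elem T ((word_elem (dual T) u ^^ k) w) u
             = word_elem T ((word_elem (dual T) u ^^ k) w') u"
  shows "word_elem T w (concat (replicate n u)) = word_elem T w' (concat (replicate n u))"
  using assms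
proof (induction n arbitrary: w w')
  case 0
  have "word_elem T x [] = []" for x
    by (metis length_0_conv length_word_elem)
  then show ?case by simp
next
  case (Suc n)
  let ?s = "word_elem (dual T) u"
  have "word_elem T w u = word_elem T w' u"
    using Suc.prems[of 0] by simp
  moreover have "word_elem T ((?s ^^ k) (?s w)) u = word_elem T ((?s ^^ k) (?s w')) u" for k
    using Suc.prems[of "Suc k"] by (simp add: funpow_swap1)
  then have "word_elem T (?s w) (concat (replicate n u))
           = word_elem T (?s w') (concat (replicate n u))"
    by (rule Suc.IH)
  ultimately show ?case
    by (simp add: word_elem_dual_append)
qed

lemma word_elem_prefix_eqD:
  assumes "word_elem T w (u @ v) = word_elem T w' (u @ v)"
  shows "word_elem T w u = word_elem T w' u"
  using assms by (simp add: word_elem_dual_append)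

lemma stake_cycle_eq_concat:
  assumes "u \<noteq> []"
  shows "stake (n * length u) (cycle u) = concat (replicate n u)"
proof (induction n)
  case (Suc n)
  have "stake (Suc n * length u) (cycle u) = stake (length u + n * length u) (u @- cycle u)"
    by (subst cycle_decomp[OF assms]) simp
  also have "\<dots> = u @ stake (n * length u) (cycle u)"
    by (simp add: stake_shift)
  finally show ?case
    using Suc.IH by simp
qed simp

lemma word_elem_stake_cycle_eqI:
  assumes "u \<noteq> []"
    and "\<And>k. word_elem T ((word_elem (dual T) u ^^ k) w) u
           = word_elem T ((word_elem (dual T) u ^^ k) w') u"
  shows "word_elem T w (stake n (cycle u)) = word_elem T w' (stake n (cycle u))"
proof -
  have "n \<le> n * length u"
    using assms(1) by (cases u) auto
  then obtain m where "n * length u = n + m"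
    using le_Suc_ex by blast
  then have "concat (replicate n u) = stake n (cycle u) @ stake m (sdrop n (cycle u))"
    using stake_cycle_eq_concat[OF assms(1), of n] by (simp add: stake_add)
  with word_elem_power_eqI[of T u w w' n, OF assms(2)] show ?thesis
    by (metis word_elem_prefix_eqD)
qed

text \<open>
  The dual of the enriched dual is the original transducer together with a copy \<open>Inr q\<close> of each
  state in which every edge is reversed; reversing the edges inverts the action.
\<close>

lemma act_dual_enriched_dual_Inl: "act (dual (enriched_dual T)) (Inl q) = act T q"
proof
  fix v show "act (dual (enriched_dual T)) (Inl q) v = act T q v"
    by (induction v arbitrary: q) (simp_all add: dual_def enriched_dual_def)
qed

lemma act_dual_enriched_dual_Inr:
  assumes "invertible_transducer T"
  shows "act (dual (enriched_dual T)) (Inr q) (act T q v) = v"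
proof (induction v arbitrary: q)
  case (Cons a v)
  have "inj (out_letter T q)"
    using assms by (simp add: invertible_transducer_def bij_is_inj)
  then have "(THE c. out_letter T q c = out_letter T q a) = a"
    by (auto dest: injD)
  with Cons.IH show ?case
    by (simp add: dual_def enriched_dual_def)
qed simp

lemma transducer_group_elem_word:
  assumes "invertible_transducer T" and "g \<in> carrier (transducer_group T)"
  obtains w where "g = word_elem (dual (enriched_dual T)) w"
proof -
  let ?D = "dual (enriched_dual T)"
  interpret B: group "BijGroup (UNIV :: 'b list set)"
    by (rule group_BijGroup)
  have "g \<in> generate (BijGroup UNIV) (range (act T))"
    using assms(2) by (simp add: transducer_group_def)
  then have "g \<in> carrier (BijGroup UNIV) \<and> (\<exists>w. g = word_elem ?D w)"
  proof induction
    case one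
    have "\<one>\<^bsub>BijGroup UNIV\<^esub> = word_elem ?D []"
      by (simp add: BijGroup_def fun_eq_iff)
    then show ?case by (metis B.one_closed)
  next
    case (incl h)
    then obtain q where "h = act T q" by blast
    then have "h = word_elem ?D [Inl q]"
      by (simp add: act_dual_enriched_dual_Inl)
    with \<open>h = act T q\<close> show ?case
      using act_in_BijGroup[OF assms(1)] by blast
  next
    case (inv h)
    then obtain q where q: "h = act T q" by blast
    then have h: "h \<in> carrier (BijGroup UNIV)"
      using act_in_BijGroup[OF assms(1)] by blast
    then have "h \<in> Bij UNIV" "bij h"
      by (simp_all add: BijGroup_def Bij_def)
    then have "inv\<^bsub>BijGroup UNIV\<^esub> h = inv_into UNIV h"
      by (simp add: inv_BijGroup restrict_def)
    also have "\<dots> = act ?D (Inr q)"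
    proof
      fix v
      have "act ?D (Inr q) (h (inv_into UNIV h v)) = inv_into UNIV h v"
        unfolding q by (rule act_dual_enriched_dual_Inr[OF assms(1)])
      then show "inv_into UNIV h v = act ?D (Inr q) v"
        using \<open>bij h\<close> by (simp add: bij_is_surj surj_f_inv_f)
    qed
    also have "\<dots> = word_elem ?D [Inr q]" by simp
    finally show ?case
      using B.inv_closed[OF h] by blast
  next
    case (eng h1 h2)
    then obtain w1 w2 where "h1 = word_elem ?D w1" "h2 = word_elem ?D w2" by blast
    moreover have "h1 \<otimes>\<^bsub>BijGroup UNIV\<^esub> h2 = h1 \<circ> h2"
      using eng.IH by (simp add: BijGroup_def compose_def restrict_def comp_def)
    ultimately have "h1 \<otimes>\<^bsub>BijGroup UNIV\<^esub> h2 = word_elem ?D (w2 @ w1)"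
      by (simp add: word_elem_append)
    with eng.IH show ?case
      using B.m_closed by blast
  qed
  with that show thesis by blast
qed

lemma stream_act_cong_stake:
  assumes "\<And>n. g (stake n \<xi>) = h (stake n \<xi>)"
  shows "stream_act g \<xi> = stream_act h \<xi>"
  unfolding stream_act_def by (simp only: assms)

lemma stream_act_one: "stream_act \<one>\<^bsub>transducer_group T\<^esub> \<xi> = \<xi>"
  unfolding stream_act_def smap_alt
  by (simp add: transducer_group_def BijGroup_def del: stake.simps)

text \<open>
  The witness is \<open>h\<inverse>g\<close>. Agreement of \<open>g\<close> and \<open>h\<close> on \<open>\<xi>\<close> is stated on prefixes, where products of
  group elements are compositions of maps.
\<close>

lemma stabilizer_nontrivialI:
  assumes "invertible_transducer T"
    and g: "g \<in> carrier (transducer_group T)" and h: "h \<in> carrier (transducer_group T)"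
    and "g \<noteq> h" and eq: "\<And>n. g (stake n \<xi>) = h (stake n \<xi>)"
  shows "stabilizer (transducer_group T) stream_act \<xi> \<noteq> {\<one>\<^bsub>transducer_group T\<^esub>}"
proof -
  let ?G = "transducer_group T"
  interpret G: group ?G
    using assms(1) by (rule group_transducer_group)
  let ?h' = "inv\<^bsub>?G\<^esub> h"
  have sub: "carrier ?G \<subseteq> carrier (BijGroup UNIV)"
    unfolding transducer_group_def
    using group.generate_incl[OF group_BijGroup, of "range (act T)" UNIV]
      act_in_BijGroup[OF assms(1)] by (auto simp: image_subset_iff)
  have mult: "(x \<otimes>\<^bsub>?G\<^esub> y) v = x (y v)" if "x \<in> carrier ?G" "y \<in> carrier ?G" for x y v
    using that sub by (auto simp: transducer_group_def BijGroup_def compose_def)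
  have "(?h' \<otimes>\<^bsub>?G\<^esub> g) (stake n \<xi>) = \<one>\<^bsub>?G\<^esub> (stake n \<xi>)" for n
    using mult[OF _ g, of ?h'] mult[OF _ h, of ?h'] g h eq by (metis G.inv_closed G.l_inv)
  then have "stream_act (?h' \<otimes>\<^bsub>?G\<^esub> g) \<xi> = \<xi>"
    using stream_act_cong_stake stream_act_one by metis
  then have "?h' \<otimes>\<^bsub>?G\<^esub> g \<in> stabilizer ?G stream_act \<xi>"
    using g h by (simp add: stabilizer_def)
  moreover have "?h' \<otimes>\<^bsub>?G\<^esub> g \<noteq> \<one>\<^bsub>?G\<^esub>"
    using g h \<open>g \<noteq> h\<close> by (metis G.inv_closed G.inv_equality G.inv_inv)
  ultimately show ?thesis by blast
qed

theorem theorem7: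
  fixes T :: "('q::finite, 'a::finite) transducer" and u :: "'a list"
  assumes "invertible_transducer T"
    and "infinite (carrier (transducer_group T))"
    and "u \<noteq> []"
    and "finite_order (word_elem (enriched_dual T) u)"
  shows "stabilizer (transducer_group T) stream_act (cycle u) \<noteq> {\<one>\<^bsub>transducer_group T\<^esub>}"
proof -
  let ?G = "transducer_group T" and ?D = "dual (enriched_dual T)"
  let ?s = "word_elem (enriched_dual T) u"
  define S where "S = range (\<lambda>k. ?s ^^ k)"
  \<comment> \<open>The finite invariant of a word \<open>w\<close> that determines the image of \<open>u\<^sup>\<omega>\<close> under it.\<close>
  define \<kappa> where "\<kappa> w = (\<lambda>f\<in>S. word_elem ?D (f w) u)" for w
  have S_sub: "S \<subseteq> insert id {?s ^^ i | i. i \<ge> 1}"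
  proof
    fix f assume "f \<in> S"
    then obtain k where "f = ?s ^^ k" by (auto simp: S_def)
    then show "f \<in> insert id {?s ^^ i | i. i \<ge> 1}"
      by (cases "k = 0") (auto intro!: exI[of _ k])
  qed
  have "finite (insert id {?s ^^ i | i. i \<ge> 1})"
    using assms(4) unfolding finite_order_def by (rule finite.insertI)
  with S_sub have "finite S"
    by (rule finite_subset)
  moreover have "finite {v :: 'a list. length v = length u}"
    using finite_lists_length_eq[of "UNIV :: 'a set" "length u"] by simp
  ultimately have "finite (S \<rightarrow>\<^sub>E {v :: 'a list. length v = length u})"
    by (intro finite_PiE) auto
  moreover have "range \<kappa> \<subseteq> S \<rightarrow>\<^sub>E {v. length v = length u}"
    by (auto simp: \<kappa>_def)
  ultimately have fin: "finite (range \<kappa>)"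
    by (rule finite_subset[rotated])
  have "\<forall>g\<in>carrier ?G. \<exists>w. word_elem ?D w = g"
  proof
    fix g assume "g \<in> carrier ?G"
    with assms(1) obtain w where "g = word_elem ?D w"
      by (rule transducer_group_elem_word)
    then show "\<exists>w. word_elem ?D w = g" by blast
  qed
  then obtain wd where wd: "\<forall>g\<in>carrier ?G. word_elem ?D (wd g) = g"
    by (rule bchoice[THEN exE])
  have "finite ((\<kappa> \<circ> wd) ` carrier ?G)"
    using fin by (rule finite_subset[rotated]) auto
  with assms(2) have "\<not> inj_on (\<kappa> \<circ> wd) (carrier ?G)"
    by (blast dest: finite_imageD)
  then obtain g h where gh: "g \<in> carrier ?G" "h \<in> carrier ?G" "g \<noteq> h"
    and eq: "\<kappa> (wd g) = \<kappa> (wd h)"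
    by (auto simp: inj_on_def)
  have "word_elem ?D ((?s ^^ k) (wd g)) u = word_elem ?D ((?s ^^ k) (wd h)) u" for k
    using fun_cong[OF eq, of "?s ^^ k"] by (simp add: \<kappa>_def S_def)
  then have "word_elem ?D (wd g) (stake n (cycle u)) = word_elem ?D (wd h) (stake n (cycle u))" for n
    by (intro word_elem_stake_cycle_eqI[OF assms(3)]) (simp only: dual_dual)
  then have "g (stake n (cycle u)) = h (stake n (cycle u))" for n
    using wd gh by simp
  with assms(1) gh show ?thesis
    by (intro stabilizer_nontrivialI)
qed

end
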